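(* Let $\lambda\in\mathbb{R}$, let $\alpha$ be a positive integer and let $m\in\mathbb{N}$ with $m\ge\alpha$. Then \[ \sum_{k=\alpha}^{m}(k)_{\alpha,\lambda}=\sum_{k=1}^{m}S_{2,\lambda}(\alpha,k)\,k!\binom{m+1}{k+1}-\sum_{k=1}^{\alpha-1}S_{2,\lambda}(\alpha,k)\,k!\binom{\alpha}{k+1}. \]
   Context: For $\lambda\in\mathbb{R}$, the generalized falling factorial polynomials are $(x)_{0,\lambda}=1$ and $(x)_{n,\lambda}=x(x-\lambda)\cdots(x-(n-1)\lambda)$ for $n\ge1$. The ordinary falling factorial is $(x)_0=1$, $(x)_n=x(x-1)\cdots(x-n+1)$. The degenerate Stirling numbers of the second kind $S_{2,\lambda}(n,k)$ are defined by $(x)_{n,\lambda}=\sum_{k=0}^{n}S_{2,\lambda}(n,k)(x)_{k}$ for all $n\ge 0$, with $S_{2,\lambda}(n,k)=0$ for $k>n$ or $k<0$. *)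

theory Defs
  imports Complex_Main
begin

definition gen_falling_fact :: "real \<Rightarrow> real \<Rightarrow> nat \<Rightarrow> real" where
  "gen_falling_fact lam x n = (\<Prod>i<n. x - real i * lam)"

definition falling_fact :: "real \<Rightarrow> nat \<Rightarrow> real" where
  "falling_fact x n = (\<Prod>i<n. x - real i)"

definition is_deg_Stirling2_row :: "real \<Rightarrow> nat \<Rightarrow> (nat \<Rightarrow> real) \<Rightarrow> bool" where
  "is_deg_Stirling2_row lam n c \<longleftrightarrow>
     (\<forall>x. gen_falling_fact lam x n = (\<Sum>k=0..n. c k * falling_fact x k)) \<and> (\<forall>k>n. c k = 0)"

text \<open>
  The row of degenerate Stirling numbers is the unique solution of its defining identity; existence
  and uniqueness are shown in \<open>deg_Stirling2_row_ex1\<close> below, so the description is proper.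
\<close>

definition deg_Stirling2 :: "real \<Rightarrow> nat \<Rightarrow> nat \<Rightarrow> real" where
  "deg_Stirling2 lam n = (THE c. is_deg_Stirling2_row lam n c)"

lemma falling_fact_of_nat_eq_0: "j < k \<Longrightarrow> falling_fact (real j) k = 0"
  by (auto simp: falling_fact_def)

lemma falling_fact_of_nat_self_nonzero: "falling_fact (real j) j \<noteq> 0"
  by (auto simp: falling_fact_def)

lemma deg_Stirling2_row_unique:
  assumes "is_deg_Stirling2_row lam n c" and "is_deg_Stirling2_row lam n d"
  shows "c = d"
proof
  fix k show "c k = d k"
  proof (induction k rule: less_induct)
    case (less j)
    show ?case
    proof (cases "j \<le> n")
      case False
      then show ?thesis using assms by (simp add: is_deg_Stirling2_row_def)
    next
      case True
      have split: "(\<Sum>k=0..n. e k * falling_fact (real j) k)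
          = (\<Sum>k<j. e k * falling_fact (real j) k) + e j * falling_fact (real j) j" for e
      proof -
        have "(\<Sum>k=0..n. e k * falling_fact (real j) k) = (\<Sum>k\<in>{..<Suc j}. e k * falling_fact (real j) k)"
          by (rule sum.mono_neutral_right) (use True in \<open>auto simp: falling_fact_of_nat_eq_0\<close>)
        then show ?thesis by simp
      qed
      have "(\<Sum>k=0..n. c k * falling_fact (real j) k) = (\<Sum>k=0..n. d k * falling_fact (real j) k)"
        using assms unfolding is_deg_Stirling2_row_def by metis
      moreover have "(\<Sum>k<j. c k * falling_fact (real j) k) = (\<Sum>k<j. d k * falling_fact (real j) k)"
        by (rule sum.cong) (use less in auto)
      ultimately show ?thesis
        by (simp add: split falling_fact_of_nat_self_nonzero)
    qed
  qed
qed

lemma deg_Stirling2_row_exists: "\<exists>c. is_deg_Stirling2_row lam n c"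
proof (induction n)
  case 0
  have "is_deg_Stirling2_row lam 0 (\<lambda>k. if k = 0 then 1 else 0)"
    by (simp add: is_deg_Stirling2_row_def gen_falling_fact_def falling_fact_def)
  then show ?case by blast
next
  case (Suc n)
  then obtain c where c: "is_deg_Stirling2_row lam n c" ..
  define d where "d k = (if k = 0 then 0 else c (k - 1)) + (real k - real n * lam) * c k" for k
  have "is_deg_Stirling2_row lam (Suc n) d"
    unfolding is_deg_Stirling2_row_def
  proof (intro conjI allI impI)
    fix k assume "k > Suc n"
    then show "d k = 0" using c by (auto simp: d_def is_deg_Stirling2_row_def)
  next
    fix x
    have z: "c (Suc n) = 0" using c by (simp add: is_deg_Stirling2_row_def)
    have "gen_falling_fact lam x (Suc n) = (\<Sum>k=0..n. c k * falling_fact x k) * (x - real n * lam)"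
      using c by (simp add: is_deg_Stirling2_row_def gen_falling_fact_def)
    also have "\<dots> = (\<Sum>k=0..n. c k * falling_fact x (Suc k)
                     + (real k - real n * lam) * c k * falling_fact x k)"
      unfolding sum_distrib_right
      by (rule sum.cong) (auto simp: falling_fact_def algebra_simps)
    also have "\<dots> = (\<Sum>k=0..n. c k * falling_fact x (Suc k))
                   + (\<Sum>k=0..Suc n. (real k - real n * lam) * c k * falling_fact x k)"
      by (simp add: sum.distrib z)
    also have "(\<Sum>k=0..n. c k * falling_fact x (Suc k))
             = (\<Sum>k=0..Suc n. (if k = 0 then 0 else c (k - 1)) * falling_fact x k)"
      by (simp only: sum.atLeast0_atMost_Suc_shift) simp
    finally show "gen_falling_fact lam x (Suc n) = (\<Sum>k=0..Suc n. d k * falling_fact x k)"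
      by (simp only: d_def distrib_right sum.distrib)
  qed
  then show ?case by blast
qed

lemma deg_Stirling2_row_ex1: "\<exists>!c. is_deg_Stirling2_row lam n c"
  using deg_Stirling2_row_exists deg_Stirling2_row_unique by blast

lemma deg_Stirling2_row: "is_deg_Stirling2_row lam n (deg_Stirling2 lam n)"
  unfolding deg_Stirling2_def by (rule theI'[OF deg_Stirling2_row_ex1])

end

theory Submission
  imports Defs
begin

text \<open>The sum over \<open>{\<alpha>..m}\<close> is the difference of the initial sums over
  \<open>j < m + 1\<close> and \<open>j < \<alpha>\<close>, and
  \<open>sum_gen_falling_fact_lessThan\<close> evaluates both. There each term is expanded in
  ordinary falling factorials, which at a natural number j are k! times a binomial coefficient;
  after swapping the sums, the hockey-stick identity \<open>sum_choose_lessThan\<close> sums over j.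
  The upper limits m and \<alpha> - 1 arise by adding or dropping zero terms.\<close>

lemma falling_fact_of_nat: "falling_fact (real j) k = fact k * real (j choose k)"
  by (simp add: falling_fact_def binomial_gbinomial gbinomial_prod_rev atLeast0LessThan)

text \<open>Hockey-stick identity; the induction step is Pascal's rule.\<close>

lemma sum_choose_lessThan: "(\<Sum>j<n. j choose k) = n choose Suc k"
  by (induction n) simp_all

text \<open>Evaluate the defining identity at x = 0: on the right only k = 0 survives, and on the
  left the factor for i = 0 is x itself. This lets the sums start at k = 1.\<close>

lemma deg_Stirling2_0_right:
  assumes "n \<ge> 1"
  shows "deg_Stirling2 lam n 0 = 0"
proof -
  have "gen_falling_fact lam 0 n = (\<Sum>k=0..n. deg_Stirling2 lam n k * falling_fact 0 k)"
    using deg_Stirling2_row[of lam n] unfolding is_deg_Stirling2_row_def by blast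
  also have "\<dots> = (\<Sum>k\<in>{0}. deg_Stirling2 lam n k * falling_fact 0 k)"
    using falling_fact_of_nat_eq_0[of 0] by (intro sum.mono_neutral_right) auto
  also have "\<dots> = deg_Stirling2 lam n 0"
    by (simp add: falling_fact_def)
  finally have "deg_Stirling2 lam n 0 = gen_falling_fact lam 0 n" ..
  also have "\<dots> = 0"
    unfolding gen_falling_fact_def
    using assms by (intro prod_zero bexI[of _ 0]) simp_all
  finally show ?thesis .
qed

lemma sum_gen_falling_fact_lessThan:
  assumes "n \<ge> 1"
  shows "(\<Sum>j<N. gen_falling_fact lam (real j) n) =
    (\<Sum>k=1..n. deg_Stirling2 lam n k * fact k * real (N choose (k + 1)))"
proof -
  have "(\<Sum>j<N. gen_falling_fact lam (real j) n) =
      (\<Sum>j<N. \<Sum>k=0..n. deg_Stirling2 lam n k * (fact k * real (j choose k)))"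
    using deg_Stirling2_row[of lam n] by (simp add: is_deg_Stirling2_row_def falling_fact_of_nat)
  also have "\<dots> = (\<Sum>k=0..n. deg_Stirling2 lam n k * fact k * real (\<Sum>j<N. j choose k))"
    by (subst sum.swap) (simp add: sum_distrib_left mult.assoc)
  also have "\<dots> = (\<Sum>k=0..n. deg_Stirling2 lam n k * fact k * real (N choose (k + 1)))"
    by (simp only: sum_choose_lessThan Suc_eq_plus1)
  also have "\<dots> = (\<Sum>k=1..n. deg_Stirling2 lam n k * fact k * real (N choose (k + 1)))"
    by (simp add: sum.atLeast_Suc_atMost[of 0 n] deg_Stirling2_0_right[OF assms])
  finally show ?thesis .
qed

theorem theorem2:
  fixes lam :: real and \<alpha> m :: nat
  assumes "\<alpha> \<ge> 1" and "m \<ge> \<alpha>"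
  shows "(\<Sum>k=\<alpha>..m. gen_falling_fact lam (real k) \<alpha>) =
    (\<Sum>k=1..m. deg_Stirling2 lam \<alpha> k * fact k * real ((m + 1) choose (k + 1)))
    - (\<Sum>k=1..\<alpha> - 1. deg_Stirling2 lam \<alpha> k * fact k * real (\<alpha> choose (k + 1)))"
proof -
  have split: "{..<m + 1} = {..<\<alpha>} \<union> {\<alpha>..m}"
    using assms by auto
  have "(\<Sum>j<m + 1. gen_falling_fact lam (real j) \<alpha>) =
      (\<Sum>j<\<alpha>. gen_falling_fact lam (real j) \<alpha>) + (\<Sum>k=\<alpha>..m. gen_falling_fact lam (real k) \<alpha>)"
    unfolding split by (rule sum.union_disjoint) auto
  \<comment> \<open>The added terms vanish because the Stirling row is zero beyond \<alpha>.\<close>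
  moreover have "(\<Sum>k=1..\<alpha>. deg_Stirling2 lam \<alpha> k * fact k * real ((m + 1) choose (k + 1))) =
      (\<Sum>k=1..m. deg_Stirling2 lam \<alpha> k * fact k * real ((m + 1) choose (k + 1)))"
    using assms deg_Stirling2_row[of lam \<alpha>]
    by (intro sum.mono_neutral_left) (auto simp: is_deg_Stirling2_row_def)
  \<comment> \<open>The dropped term k = \<alpha> contains
    \<open>\<alpha> choose (\<alpha> + 1)\<close>, which is 0.\<close>
  moreover have "(\<Sum>k=1..\<alpha>. deg_Stirling2 lam \<alpha> k * fact k * real (\<alpha> choose (k + 1))) =
      (\<Sum>k=1..\<alpha> - 1. deg_Stirling2 lam \<alpha> k * fact k * real (\<alpha> choose (k + 1)))"
    by (intro sum.mono_neutral_right) auto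
  ultimately show ?thesis
    by (simp only: sum_gen_falling_fact_lessThan[OF assms(1)])
qed

end
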